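(* Let $0\le\alpha<1$ and let $h(z)=z+\sum_{n=2}^{\infty}a_nz^n$ and $g(z)=\sum_{n=1}^{\infty}b_nz^n$ be power series whose coefficients satisfy (with $a_1=1$) $$|a_n|\le\frac{n+1}{2}\quad\text{and}\quad |b_n|\le\frac{n-1}{2}\qquad\text{for all } n\ge1.$$ Then $f=h+\overline{g}$ is univalent and fully convex of order $\alpha$ in the disk $|z|<r_C$, where $r_C=r_C(\alpha)$ is the real root of the equation $$2(1-\alpha)(1-r)^4+\alpha(1-r)^2-(r^2+4r+1)=0$$ in the interval $(0,1)$. In particular, $f$ is univalent and fully convex in $|z|<r_C(0)\approx0.0903331$.
   Context: A complex-valued harmonic function $f$ is said to be fully convex of order $\alpha$ ($0\le\alpha<1$) in a disk $|z|<\rho$ if, for every $0<r<\rho$, $f$ maps the circle $|z|=r$ in a one-to-one manner onto a convex curve satisfying $\frac{\partial}{\partial\theta}\left(\arg\left\{\frac{\partial}{\partial\theta}f(re^{i\theta})\right\}\right)>\alpha$ for $0\le\theta\le2\pi$. Fully convex means fully convex of order $0$. *)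

theory Defs
  imports "HOL-Analysis.Analysis"
begin

text \<open>
  \<open>f\<close> is twice continuously (real) differentiable on the open set \<open>S\<close> and satisfies Laplace's
  equation there. With \<open>z = x + i y\<close>, the function \<open>fxy\<close> is the partial derivative of \<open>fx\<close> in the
  direction \<open>y\<close>, and so on.
\<close>
definition harmonic_on :: "(complex \<Rightarrow> complex) \<Rightarrow> complex set \<Rightarrow> bool" where
  "harmonic_on f S \<longleftrightarrow> open S \<and>
     (\<exists>fx fy fxx fxy fyx fyy.
        (\<forall>z\<in>S.
           (f has_derivative (\<lambda>w. Re w *\<^sub>R fx z + Im w *\<^sub>R fy z)) (at z) \<and>
           (fx has_derivative (\<lambda>w. Re w *\<^sub>R fxx z + Im w *\<^sub>R fxy z)) (at z) \<and>
           (fy has_derivative (\<lambda>w. Re w *\<^sub>R fyx z + Im w *\<^sub>R fyy z)) (at z) \<and>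
           fxx z + fyy z = 0) \<and>
        continuous_on S fxx \<and> continuous_on S fxy \<and>
        continuous_on S fyx \<and> continuous_on S fyy)"

text \<open>
  A closed convex curve in the plane: the boundary of a compact convex set with nonempty interior.
\<close>
definition convex_curve :: "complex set \<Rightarrow> bool" where
  "convex_curve C \<longleftrightarrow>
     (\<exists>K. compact K \<and> convex K \<and> interior K \<noteq> {} \<and> C = frontier K)"

text \<open>
  The derivative of \<open>arg w\<close> at \<open>\<theta>\<close> is \<open>D\<close>. Here \<open>arg\<close> is an arbitrary branch \<open>\<phi>\<close> of the argument of
  the nowhere vanishing curve \<open>w\<close> near \<open>\<theta>\<close>, differentiable at \<open>\<theta>\<close>; the principal value would
  jump. Two such branches differ by a constant near \<open>\<theta>\<close>, so \<open>D\<close> is independent of the choice.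
\<close>
definition has_arg_derivative :: "(real \<Rightarrow> complex) \<Rightarrow> real \<Rightarrow> real \<Rightarrow> bool" where
  "has_arg_derivative w D \<theta> \<longleftrightarrow>
     (\<exists>\<phi>. (\<forall>\<^sub>F t in nhds \<theta>. w t \<noteq> 0 \<and> w t = of_real (cmod (w t)) * cis (\<phi> t)) \<and>
          (\<phi> has_real_derivative D) (at \<theta>))"

text \<open>
  The curve \<open>\<lambda>t. f (r e\<^sup>i\<^sup>t)\<close> is differentiable because \<open>f\<close> is harmonic on the disk, so
  \<open>vector_derivative\<close> is its actual derivative.
\<close>
definition fully_convex_of_order :: "real \<Rightarrow> (complex \<Rightarrow> complex) \<Rightarrow> real \<Rightarrow> bool" where
  "fully_convex_of_order \<alpha> f \<rho> \<longleftrightarrow>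
     harmonic_on f (ball 0 \<rho>) \<and>
     (\<forall>r. 0 < r \<and> r < \<rho> \<longrightarrow>
        inj_on f (sphere 0 r) \<and> convex_curve (f ` sphere 0 r) \<and>
        (\<forall>\<theta>\<in>{0..2*pi}. \<exists>D > \<alpha>.
           has_arg_derivative
             (\<lambda>t. vector_derivative (\<lambda>s. f (of_real r * cis s)) (at t)) D \<theta>))"

abbreviation fully_convex :: "(complex \<Rightarrow> complex) \<Rightarrow> real \<Rightarrow> bool" where
  "fully_convex \<equiv> fully_convex_of_order 0"

definition rC_root :: "real \<Rightarrow> real \<Rightarrow> bool" where
  "rC_root \<alpha> r \<longleftrightarrow> 0 < r \<and> r < 1 \<and>
     2 * (1 - \<alpha>) * (1 - r)^4 + \<alpha> * (1 - r)^2 - (r^2 + 4 * r + 1) = 0"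

definition r_C :: "real \<Rightarrow> real" where
  "r_C \<alpha> = (THE r. rC_root \<alpha> r)"

end

theory Submission
  imports Defs
begin

text \<open>
  Write \<open>B = z h'(z) - cnj (z g'(z))\<close> and \<open>A = z (z h')'(z) + cnj (z (z g')'(z))\<close>. Along the circle
  \<open>z = r e\<^sup>i\<^sup>t\<close> the velocity of \<open>f\<close> is \<open>\<i> B\<close> and \<open>dB/dt = \<i> A\<close>, so the tangent turns at the rate
  \<open>Re (A/B)\<close>. The inequality \<open>Re (A/B) > \<alpha>\<close> says that \<open>A/B\<close> lies nearer to \<open>1 + \<alpha>\<close> than to
  \<open>-(1 - \<alpha>)\<close>, that is, \<open>\<bar>A - (1 + \<alpha>) B\<bar> < \<bar>A + (1 - \<alpha>) B\<bar>\<close>. For \<open>f z = z\<close> the two sides, divided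
  by \<open>r\<close>, are \<open>\<alpha>\<close> and \<open>2 - \<alpha>\<close>, so it suffices that the remaining terms of \<open>h\<close> and \<open>g\<close> perturb them by
  less than \<open>2 (1 - \<alpha>)\<close> in total. With the assumed coefficient bounds this total is at most
  \<open>2 (\<Sum>n\<ge>2. n (n\<^sup>2 - \<alpha>) r\<^bsup>n-1\<^esup>)\<close>, and the closed forms of \<open>\<Sum>n. n\<^sup>3 r\<^bsup>n-1\<^esup>\<close> and \<open>\<Sum>n. n r\<^bsup>n-1\<^esup>\<close> turn
  the requirement into positivity of the polynomial that defines \<open>r_C \<alpha>\<close>. That polynomial is
  strictly decreasing on \<open>[0, 1]\<close>, hence positive exactly to the left of its unique root
  (lemmas \<open>rC_polynomial_pos\<close>, \<open>total_error_bound\<close>).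

  The same four perturbations control \<open>h' - 1\<close> and \<open>g'\<close>, because these are differences of them: one
  gets \<open>\<bar>h' - 1\<bar> + \<bar>g'\<bar> < 1\<close>. So the derivative of \<open>f\<close> moves every vector within
  less than its own length, and \<open>f\<close> is injective by integrating along segments (lemma
  \<open>inj_on_if_derivative_near_identity\<close>).

  It remains to see that a circle is mapped onto the boundary of a convex body. Since
  \<open>\<bar>h' - 1\<bar> + \<bar>g'\<bar> < 1\<close>, the velocity of the image curve stays within a right angle of that of the circle, so the
  tangent angle has a global lift \<open>\<psi>\<close> that increases by exactly \<open>2 \<pi>\<close> per turn, and strictly. Hence in
  each direction \<open>u\<close> the linear functional \<open>u \<bullet> _\<close> first decreases and then increases along
  the curve, starting from the point where \<open>u\<close> is the outer normal: that point is its only maximum. A compact set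
  that has a single maximiser in every direction, and all of whose points are maximisers, is the
  frontier of its convex hull (lemmas \<open>convex_curve_if_strictly_supported\<close>,
  \<open>convex_curve_if_locally_strictly_convex\<close>).
\<close>

section \<open>The radius of full convexity\<close>

text \<open>
  Each of \<open>(1 - r)\<^sup>4\<close>, \<open>(1 - r)\<^sup>2\<close> and \<open>-(r\<^sup>2 + 4 r + 1)\<close> decreases on \<open>[0, 1]\<close>, and \<open>0 \<le> \<alpha> < 1\<close>
  makes the weights nonnegative. Uniqueness of the root, the sign to its left and its numerical value all follow.
\<close>
lemma rC_polynomial_decreasing:
  fixes \<alpha> r s :: real
  assumes "0 \<le> \<alpha>" "\<alpha> < 1" "0 \<le> r" "r < s" "s \<le> 1"
  shows "2 * (1 - \<alpha>) * (1 - s)^4 + \<alpha> * (1 - s)^2 - (s^2 + 4 * s + 1)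
       < 2 * (1 - \<alpha>) * (1 - r)^4 + \<alpha> * (1 - r)^2 - (r^2 + 4 * r + 1)"
proof -
  have "(1 - s)^4 \<le> (1 - r)^4" "(1 - s)^2 \<le> (1 - r)^2" "r^2 \<le> s^2"
    using assms by (auto intro!: power_mono)
  hence "2 * (1 - \<alpha>) * (1 - s)^4 \<le> 2 * (1 - \<alpha>) * (1 - r)^4"
    "\<alpha> * (1 - s)^2 \<le> \<alpha> * (1 - r)^2" "r^2 \<le> s^2"
    using assms by (auto intro!: mult_left_mono)
  thus ?thesis using assms by linarith
qed

lemma rC_root_ex1:
  assumes "0 \<le> \<alpha>" "\<alpha> < 1"
  shows "\<exists>!r. rC_root \<alpha> r"
proof -
  define p where "p r = 2 * (1 - \<alpha>) * (1 - r)^4 + \<alpha> * (1 - r)^2 - (r^2 + 4 * r + 1)" for r :: real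
  have dec: "p s < p r" if "0 \<le> r" "r < s" "s \<le> 1" for r s
    using rC_polynomial_decreasing[OF assms that] by (simp add: p_def)
  have "\<exists>r. 0 \<le> r \<and> r \<le> 1 \<and> p r = 0"
    by (rule IVT2) (use assms in \<open>auto simp: p_def intro!: continuous_intros\<close>)
  then obtain r where r: "0 \<le> r" "r \<le> 1" "p r = 0" by blast
  have "r \<noteq> 0" "r \<noteq> 1" using r(3) assms by (auto simp: p_def)
  hence root: "rC_root \<alpha> r" using r by (simp add: rC_root_def p_def)
  show ?thesis
  proof (rule ex1I, rule root)
    fix s assume "rC_root \<alpha> s"
    hence "0 < s" "s < 1" "p s = 0" by (auto simp: rC_root_def p_def)
    thus "s = r" using dec[of s r] dec[of r s] r by (cases s r rule: linorder_cases) auto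
  qed
qed

lemma rC_root_r_C:
  assumes "0 \<le> \<alpha>" "\<alpha> < 1"
  shows "rC_root \<alpha> (r_C \<alpha>)"
  unfolding r_C_def by (rule theI'[OF rC_root_ex1[OF assms]])

lemma rC_polynomial_pos:
  assumes "0 \<le> \<alpha>" "\<alpha> < 1" "0 \<le> r" "r < r_C \<alpha>"
  shows "r^2 + 4 * r + 1 < 2 * (1 - \<alpha>) * (1 - r)^4 + \<alpha> * (1 - r)^2"
  using rC_root_r_C[OF assms(1,2)] rC_polynomial_decreasing[OF assms] by (simp add: rC_root_def)

lemma r_C_0_approx: "\<bar>r_C 0 - 0.0903331\<bar> \<le> 5 / 10^8"
proof -
  have root: "rC_root 0 (r_C 0)" by (rule rC_root_r_C) auto
  have 1: "r_C 0 \<ge> 0.09033305"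
  proof (rule ccontr)
    assume "\<not> ?thesis"
    thus False using root rC_polynomial_decreasing[of 0 "r_C 0" "0.09033305"]
      by (simp add: rC_root_def power_divide)
  qed
  have 2: "r_C 0 \<le> 0.09033315"
  proof (rule ccontr)
    assume "\<not> ?thesis"
    thus False using root rC_polynomial_decreasing[of 0 "0.09033315" "r_C 0"]
      by (simp add: rC_root_def power_divide)
  qed
  show ?thesis using 1 2 by (auto simp: abs_if field_simps)
qed

section \<open>Convex curves in terms of the tangent angle\<close>

text \<open>
  If \<open>w t\<close> always stays within a right angle of \<open>\<i> e\<^sup>i\<^sup>t\<close>, the quotient lies in the right half
  plane, where the principal logarithm is smooth. Thus \<open>t + \<pi>/2 + Im (Ln (w t / (\<i> e\<^sup>i\<^sup>t)))\<close> is a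
  global branch of the argument of \<open>w\<close>, without any lifting argument. The last two properties record
  that its deviation from \<open>t\<close> is bounded and depends only on \<open>w t\<close> and \<open>e\<^sup>i\<^sup>t\<close>; they give the total turning.
\<close>
lemma tangent_angle_lift:
  fixes w w' :: "real \<Rightarrow> complex"
  assumes w: "\<And>t. (w has_vector_derivative w' t) (at t)"
    and half_plane: "\<And>t. Re (w t * cnj (\<i> * cis t)) > 0"
  obtains \<psi> where
    "\<And>t. w t = of_real (cmod (w t)) * cis (\<psi> t)"
    "\<And>t. (\<psi> has_real_derivative Im (w' t / w t)) (at t)"
    "\<And>t. \<bar>\<psi> t - t\<bar> < 2 * pi"
    "\<And>s t. w s = w t \<Longrightarrow> cis s = cis t \<Longrightarrow> \<psi> s - s = \<psi> t - t"
proof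
  define q where "q t = w t * cnj (\<i> * cis t)" for t
  define \<psi> where "\<psi> t = t + pi / 2 + Im (Ln (q t))" for t
  have q0: "q t \<noteq> 0" for t using half_plane[of t] by (auto simp: q_def)
  have iw: "w t = q t * (\<i> * cis t)" for t
    by (simp add: q_def cis_cnj cis_mult mult.assoc)
       (simp add: complex_eq_iff)
  show "w t = of_real (cmod (w t)) * cis (\<psi> t)" for t
  proof -
    have "q t = exp (Ln (q t))" using q0 by simp
    also have "\<dots> = of_real (cmod (q t)) * cis (Im (Ln (q t)))"
      using q0 by (simp add: exp_eq_polar Re_Ln)
    finally have "w t = of_real (cmod (q t)) * (cis (Im (Ln (q t))) * cis (pi / 2) * cis t)"
      by (subst iw) (simp add: mult.assoc)
    also have "cis (Im (Ln (q t))) * cis (pi / 2) * cis t = cis (\<psi> t)"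
      by (simp only: cis_mult \<psi>_def) (simp add: add_ac)
    also have "cmod (q t) = cmod (w t)" by (simp add: q_def norm_mult)
    finally show ?thesis .
  qed
  show "(\<psi> has_real_derivative Im (w' t / w t)) (at t)" for t
  proof -
    have wn: "w t \<noteq> 0" using half_plane[of t] by auto
    have "((\<lambda>t. cis t) has_vector_derivative \<i> * cis t) (at t)"
      unfolding has_vector_derivative_complex_iff
      by (auto intro!: derivative_eq_intros)
    hence "((\<lambda>t. cnj (\<i> * cis t)) has_vector_derivative cnj (\<i> * (\<i> * cis t))) (at t)"
      by (intro derivative_intros has_vector_derivative_cnj) 
    from has_vector_derivative_mult[OF w[of t] this]
    have dq: "(q has_vector_derivative w t * cnj (\<i> * (\<i> * cis t)) + w' t * cnj (\<i> * cis t)) (at t)"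
      by (simp add: q_def[abs_def])
    have "((Ln \<circ> q) has_vector_derivative
         (w t * cnj (\<i> * (\<i> * cis t)) + w' t * cnj (\<i> * cis t)) * inverse (q t)) (at t)"
      using half_plane[of t]
      by (intro field_vector_diff_chain_at dq has_field_derivative_Ln)
         (auto simp: q_def complex_nonpos_Reals_iff)
    also have "(w t * cnj (\<i> * (\<i> * cis t)) + w' t * cnj (\<i> * cis t)) * inverse (q t) = w' t / w t - \<i>"
      using wn by (simp add: q_def field_simps)
    finally have "((\<lambda>t. Im (Ln (q t))) has_real_derivative Im (w' t / w t) - 1) (at t)"
      by (simp add: has_vector_derivative_complex_iff o_def)
    from DERIV_add[OF DERIV_add[OF DERIV_ident DERIV_const] this] show ?thesis
      unfolding \<psi>_def by simp
  qed
  show "\<bar>\<psi> t - t\<bar> < 2 * pi" for t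
  proof -
    have "\<bar>Im (Ln (q t))\<bar> < pi / 2" 
      using Re_Ln_pos_lt[OF q0[of t]] half_plane[of t] by (simp add: q_def)
    thus ?thesis by (simp add: \<psi>_def)
  qed
  show "\<psi> s - s = \<psi> t - t" if "w s = w t" "cis s = cis t" for s t
    using that by (simp add: \<psi>_def q_def)
qed

text \<open>
  The body is the convex hull \<open>K\<close> of \<open>C\<close>. Points of \<open>C\<close> have a supporting line, so they are not
  interior. Conversely a frontier point of \<open>K\<close> maximises some \<open>u \<bullet> _\<close> over \<open>K\<close>, and the only point of \<open>K\<close>
  that does so is the maximiser of \<open>u \<bullet> _\<close> in \<open>C\<close>.
\<close>
lemma convex_curve_if_strictly_supported:
  fixes C :: "complex set"
  assumes compact: "compact C" and nontriv: "p \<in> C" "q \<in> C" "p \<noteq> q"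
    and supported: "\<And>x. x \<in> C \<Longrightarrow> \<exists>u. u \<noteq> 0 \<and> (\<forall>y\<in>C. u \<bullet> y \<le> u \<bullet> x)"
    and unique_max: "\<And>u. u \<noteq> 0 \<Longrightarrow> \<exists>x\<in>C. \<forall>y\<in>C - {x}. u \<bullet> y < u \<bullet> x"
  shows "convex_curve C"
proof -
  define K where "K = convex hull C"
  have K: "compact K" "convex K" "C \<subseteq> K"
    using compact by (auto simp: K_def compact_convex_hull hull_subset)
  have below: "u \<bullet> y \<le> m" if "\<And>x. x \<in> C \<Longrightarrow> u \<bullet> x \<le> m" "y \<in> K" for u y m
    using hull_minimal[of C "{x. u \<bullet> x \<le> m}" convex] that
    by (auto simp: K_def convex_halfspace_le)
  \<comment> \<open>If \<open>K\<close> lay on a line, the normal functional would be constant on \<open>C\<close> and have no strict maximum.\<close>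
  have int: "interior K \<noteq> {}"
  proof
    assume "interior K = {}"
    then obtain u m where u: "u \<noteq> 0" "K \<subseteq> {x. u \<bullet> x = m}"
      using empty_interior_subset_hyperplane[OF K(2)] by metis
    obtain x where x: "x \<in> C" "\<And>y. y \<in> C - {x} \<Longrightarrow> u \<bullet> y < u \<bullet> x"
      using unique_max[OF u(1)] by blast
    have "u \<bullet> y = m" if "y \<in> C" for y using u(2) K(3) that by blast
    thus False using x(2)[of p] x(2)[of q] x(1) nontriv by auto
  qed
  have "C = frontier K"
  proof
    show "C \<subseteq> frontier K"
    proof
      fix x assume x: "x \<in> C"
      obtain u where u: "u \<noteq> 0" "\<forall>y\<in>C. u \<bullet> y \<le> u \<bullet> x" using supported[OF x] by blast
      have "K \<subseteq> {y. u \<bullet> y \<le> u \<bullet> x}" using below[of u "u \<bullet> x"] u(2) by auto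
      from interior_mono[OF this] have "x \<notin> interior K"
        unfolding interior_halfspace_le[OF u(1)] by auto
      thus "x \<in> frontier K" using x K(3) closure_subset[of K] by (auto simp: frontier_def)
    qed
    show "frontier K \<subseteq> C"
    proof
      fix x assume x: "x \<in> frontier K"
      hence xK: "x \<in> K" "x \<notin> interior K" 
        using closure_closed[OF compact_imp_closed[OF K(1)]] by (auto simp: frontier_def)
      have "x \<notin> rel_interior K" using xK(2) int by (simp add: rel_interior_nonempty_interior)
      moreover have closed: "closure K = K" using K(1) by (simp add: compact_imp_closed)
      ultimately obtain a where a: "a \<noteq> 0" "\<And>y. y \<in> K \<Longrightarrow> a \<bullet> x \<le> a \<bullet> y"
        using supporting_hyperplane_relative_frontier[OF K(2), of x, unfolded closed] xK(1) by metis
      define u where "u = - a"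
      have u: "u \<noteq> 0" "\<And>y. y \<in> K \<Longrightarrow> u \<bullet> y \<le> u \<bullet> x"
        using a by (auto simp: u_def)
      obtain c where c: "c \<in> C" "\<And>y. y \<in> C - {c} \<Longrightarrow> u \<bullet> y < u \<bullet> c"
        using unique_max[OF u(1)] by blast
      \<comment> \<open>An open half plane together with one point of its boundary line is convex.\<close>
      define D where "D = insert c {y. u \<bullet> y < u \<bullet> c}"
      have "convex D"
      proof -
        have "s *\<^sub>R y + t *\<^sub>R z \<in> D" if "y \<in> D" "z \<in> D" "0 < s" "0 < t" "s + t = 1" for y z s t
        proof (cases "y = c \<and> z = c")
          case True
          thus ?thesis using that(5) by (simp add: D_def flip: scaleR_left_distrib)
        next
          case False
          hence "u \<bullet> y \<le> u \<bullet> c" "u \<bullet> z \<le> u \<bullet> c" "u \<bullet> y < u \<bullet> c \<or> u \<bullet> z < u \<bullet> c"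
            using that(1,2) by (auto simp: D_def)
          hence "s * (u \<bullet> y) \<le> s * (u \<bullet> c)" "t * (u \<bullet> z) \<le> t * (u \<bullet> c)"
            "s * (u \<bullet> y) < s * (u \<bullet> c) \<or> t * (u \<bullet> z) < t * (u \<bullet> c)"
            using that(3,4) by auto
          hence "s * (u \<bullet> y) + t * (u \<bullet> z) < s * (u \<bullet> c) + t * (u \<bullet> c)" by linarith
          also have "\<dots> = u \<bullet> c" using that(5) by (simp flip: distrib_right)
          finally show ?thesis by (simp add: D_def inner_add_right)
        qed
        note interior_point = this
        show ?thesis
        proof (rule convexI)
          fix y z :: complex and s t :: real
          assume yz: "y \<in> D" "z \<in> D" "0 \<le> s" "0 \<le> t" "s + t = 1"
          then consider "s = 0" "t = 1" | "s = 1" "t = 0" | "0 < s" "0 < t" by fastforce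
          thus "s *\<^sub>R y + t *\<^sub>R z \<in> D"
            using yz interior_point[of y z s t] by cases auto
        qed
      qed
      moreover have "C \<subseteq> D" using c by (auto simp: D_def)
      ultimately have "K \<subseteq> D" unfolding K_def by (rule hull_minimal[rotated])
      hence "x \<in> D" using xK by blast
      thus "x \<in> C" using u(2)[of c] c(1) K(3) by (auto simp: D_def)
    qed
  qed
  thus ?thesis unfolding convex_curve_def using K(1,2) int by (intro exI[of _ K]) simp
qed

lemma inner_cis: "cis x \<bullet> (of_real c * cis y) = c * cos (y - x)"
  by (simp add: inner_complex_def cos_diff algebra_simps)

text \<open>
  Strict monotonicity of the tangent angle \<open>\<psi>\<close> is local; that \<open>\<psi>\<close> gains exactly \<open>2 \<pi>\<close> over a period,
  and not a larger multiple, makes the conclusion global. The outer normal at \<open>t0\<close> is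
  \<open>cis (\<psi> t0 - \<pi>/2)\<close>, since the curve runs counterclockwise.
\<close>
lemma convex_curve_if_locally_strictly_convex:
  fixes F w w' :: "real \<Rightarrow> complex"
  assumes F: "\<And>t. (F has_vector_derivative w t) (at t)"
    and w: "\<And>t. (w has_vector_derivative w' t) (at t)"
    and half_plane: "\<And>t. Re (w t * cnj (\<i> * cis t)) > 0"
    and turning: "\<And>t. Im (w' t / w t) > 0"
    and period: "\<And>t. F (t + 2 * pi) = F t" "\<And>t. w (t + 2 * pi) = w t"
  shows "convex_curve (range F)"
proof -
  obtain \<psi> where polar: "\<And>t. w t = of_real (cmod (w t)) * cis (\<psi> t)"
    and d\<psi>: "\<And>t. (\<psi> has_real_derivative Im (w' t / w t)) (at t)"
    and near: "\<And>t. \<bar>\<psi> t - t\<bar> < 2 * pi"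
    and fibre: "\<And>s t. w s = w t \<Longrightarrow> cis s = cis t \<Longrightarrow> \<psi> s - s = \<psi> t - t"
    by (rule tangent_angle_lift[OF w half_plane]) (rule that; assumption)
  have \<psi>_period: "\<psi> (t + 2 * pi) = \<psi> t + 2 * pi" for t
    using fibre[of "t + 2 * pi" t] period(2)[of t] by (simp flip: cis_mult)
  have mono: "\<psi> s < \<psi> t" if "s < t" for s t
    by (rule DERIV_pos_imp_increasing[OF that]) (use d\<psi> turning in \<open>auto intro!: exI\<close>)
  have cont: "isCont \<psi> t" for t using d\<psi> by (rule DERIV_isCont)
  have w0: "w t \<noteq> 0" for t using half_plane[of t] by auto

  have strict_max: "cis (\<psi> t0 - pi / 2) \<bullet> F t < cis (\<psi> t0 - pi / 2) \<bullet> F t0"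
    if t: "t0 < t" "t < t0 + 2 * pi" for t0 t
  proof -
    define u where "u = cis (\<psi> t0 - pi / 2)"
    have dF: "((\<lambda>t. u \<bullet> F t) has_real_derivative - cmod (w t) * sin (\<psi> t - \<psi> t0)) (at t)" for t
    proof -
      have "((\<lambda>t. u \<bullet> F t) has_real_derivative u \<bullet> w t) (at t)"
        unfolding has_real_derivative_iff_has_vector_derivative
        by (rule bounded_linear.has_vector_derivative[OF bounded_linear_inner_right F])
      also have "u \<bullet> w t = cmod (w t) * cos (\<psi> t - (\<psi> t0 - pi / 2))"
        by (subst polar) (simp only: u_def inner_cis)
      also have "cos (\<psi> t - (\<psi> t0 - pi / 2)) = - sin (\<psi> t - \<psi> t0)"
        using cos_add[of "\<psi> t - \<psi> t0" "pi / 2"] by (simp add: algebra_simps)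
      finally show ?thesis by simp
    qed
    have contF: "continuous_on S (\<lambda>t. u \<bullet> F t)" for S
      by (intro continuous_at_imp_continuous_on ballI DERIV_isCont[OF dF])
    \<comment> \<open>At \<open>t1\<close> the tangent is antiparallel to the one at \<open>t0\<close>; the functional decreases up to \<open>t1\<close>
      and then increases until it returns to its value at \<open>t0\<close>.\<close>
    have "\<exists>t1. t0 \<le> t1 \<and> t1 \<le> t0 + 2 * pi \<and> \<psi> t1 = \<psi> t0 + pi"
      by (rule IVT) (auto simp: \<psi>_period cont)
    then obtain t1 where t1: "\<psi> t1 = \<psi> t0 + pi" by blast
    show ?thesis
    proof (cases "t \<le> t1")
      case True
      have "u \<bullet> F t < u \<bullet> F t0"
      proof (rule DERIV_neg_imp_decreasing_open[OF t(1) _ contF])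
        fix s assume "t0 < s" "s < t"
        hence "\<psi> t0 < \<psi> s" "\<psi> s < \<psi> t1" using mono True by auto
        hence "sin (\<psi> s - \<psi> t0) > 0" using t1 by (intro sin_gt_zero) auto
        thus "\<exists>y. ((\<lambda>t. u \<bullet> F t) has_real_derivative y) (at s) \<and> y < 0"
          using dF w0[of s] by (intro exI[of _ "- cmod (w s) * sin (\<psi> s - \<psi> t0)"]) auto
      qed
      thus ?thesis by (simp add: u_def)
    next
      case False
      have "u \<bullet> F t < u \<bullet> F (t0 + 2 * pi)"
      proof (rule DERIV_pos_imp_increasing_open[OF t(2) _ contF])
        fix s assume "t < s" "s < t0 + 2 * pi"
        hence "\<psi> t1 < \<psi> s" "\<psi> s < \<psi> t0 + 2 * pi" using mono[of t1 s] mono[of s "t0 + 2 * pi"] False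
          by (auto simp: \<psi>_period)
        hence "sin (\<psi> s - \<psi> t0) < 0" using t1 by (intro sin_lt_zero) auto
        thus "\<exists>y. ((\<lambda>t. u \<bullet> F t) has_real_derivative y) (at s) \<and> y > 0"
          using dF w0[of s] by (intro exI[of _ "- cmod (w s) * sin (\<psi> s - \<psi> t0)"]) (auto simp: mult_less_0_iff)
      qed
      thus ?thesis by (simp add: u_def period)
    qed
  qed

  have period_int: "F (t + of_int k * (2 * pi)) = F t" for k t
  proof (induction k rule: int_induct[where k = 0])
    case (step1 i)
    thus ?case using period(1)[of "t + of_int i * (2 * pi)"] by (simp add: algebra_simps)
  next
    case (step2 i)
    thus ?case using period(1)[of "t + of_int (i - 1) * (2 * pi)"] by (simp add: algebra_simps)
  qed simp
  have reduce: "\<exists>s. t0 \<le> s \<and> s < t0 + 2 * pi \<and> F s = F t" for t0 t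
  proof -
    define k where "k = \<lfloor>(t - t0) / (2 * pi)\<rfloor>"
    have "of_int k * (2 * pi) \<le> t - t0" "t - t0 < (of_int k + 1) * (2 * pi)"
      unfolding k_def using floor_divide_lower[of "2 * pi" "t - t0"] floor_divide_upper[of "2 * pi" "t - t0"]
      by auto
    thus ?thesis
      by (intro exI[of _ "t - of_int k * (2 * pi)"])
         (use period_int[of "t - of_int k * (2 * pi)" k] in \<open>auto simp: algebra_simps\<close>)
  qed
  have unique_max: "cis (\<psi> t0 - pi / 2) \<bullet> y < cis (\<psi> t0 - pi / 2) \<bullet> F t0"
    if y: "y \<in> range F - {F t0}" for t0 y
  proof -
    obtain t where "y = F t" using y by blast
    with reduce[of t0 t] obtain s where "t0 \<le> s" "s < t0 + 2 * pi" "F s = y" by auto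
    thus ?thesis using strict_max[of t0 s] y by (cases "s = t0") auto
  qed

  show ?thesis
  proof (rule convex_curve_if_strictly_supported)
    have "range F = F ` {0..2 * pi}"
    proof
      show "range F \<subseteq> F ` {0..2 * pi}"
      proof
        fix y assume "y \<in> range F"
        then obtain t where "y = F t" by blast
        with reduce[of 0 t] obtain s where "0 \<le> s" "s < 2 * pi" "y = F s" by auto
        thus "y \<in> F ` {0..2 * pi}" by auto
      qed
    qed auto
    moreover have "continuous_on {0..2 * pi} F"
      by (intro continuous_at_imp_continuous_on ballI has_vector_derivative_continuous[OF F])
    ultimately show "compact (range F)" by (simp add: compact_continuous_image)
    show "F 0 \<in> range F" "F pi \<in> range F" by auto
    show "F 0 \<noteq> F pi" using strict_max[of 0 pi] by auto
  next
    fix x assume "x \<in> range F"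
    then obtain t0 where x: "x = F t0" by blast
    show "\<exists>u. u \<noteq> 0 \<and> (\<forall>y\<in>range F. u \<bullet> y \<le> u \<bullet> x)"
    proof (intro exI[of _ "cis (\<psi> t0 - pi / 2)"] conjI ballI)
      fix y assume "y \<in> range F"
      thus "cis (\<psi> t0 - pi / 2) \<bullet> y \<le> cis (\<psi> t0 - pi / 2) \<bullet> x"
        using unique_max[of y t0] x by (cases "y = x") auto
    qed simp
  next
    fix u :: complex assume u: "u \<noteq> 0"
    define c where "c = Arg u + pi / 2"
    \<comment> \<open>Every direction occurs as an outer normal, because \<open>\<psi>\<close> is unbounded in both directions.\<close>
    have "\<exists>t0. c - 2 * pi \<le> t0 \<and> t0 \<le> c + 2 * pi \<and> \<psi> t0 = c"
      using near[of "c - 2 * pi"] near[of "c + 2 * pi"] by (intro IVT) (auto simp: cont)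
    then obtain t0 where t0: "\<psi> t0 = c" by blast
    have "u = cmod u *\<^sub>R cis (\<psi> t0 - pi / 2)"
      using rcis_cmod_Arg[of u] by (simp add: t0 c_def rcis_def scaleR_conv_of_real)
    hence u_inner: "u \<bullet> x = cmod u * (cis (\<psi> t0 - pi / 2) \<bullet> x)" for x
      by (metis inner_scaleR_left)
    have "u \<bullet> y < u \<bullet> F t0" if "y \<in> range F - {F t0}" for y
      unfolding u_inner using unique_max[OF that] u by (intro mult_strict_left_mono) auto
    thus "\<exists>x\<in>range F. \<forall>y\<in>range F - {x}. u \<bullet> y < u \<bullet> x" by blast
  qed
qed

section \<open>Harmonic maps near the identity\<close>

lemma has_derivative_add_cnj:
  fixes h g :: "complex \<Rightarrow> complex"
  assumes "(h has_field_derivative p) (at z)" "(g has_field_derivative q) (at z)"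
  shows "((\<lambda>z. h z + cnj (g z)) has_derivative (\<lambda>w. p * w + cnj (q * w))) (at z)"
  using assms unfolding has_field_derivative_def
  by (intro has_derivative_add bounded_linear.has_derivative[OF bounded_linear_cnj]) auto

text \<open>
  The partial derivatives of \<open>h + cnj g\<close> are \<open>h' + cnj g'\<close> in the direction \<open>1\<close> and
  \<open>\<i> h' + cnj (\<i> g')\<close> in the direction \<open>\<i>\<close>. Both have again the form holomorphic plus conjugate
  holomorphic, so the same rule gives the second partials, and \<open>1 + \<i>\<^sup>2 = 0\<close> gives Laplace's equation.
\<close>
lemma harmonic_on_add_cnj:
  fixes f h g :: "complex \<Rightarrow> complex"
  assumes S: "open S"
    and h: "\<And>z. z \<in> S \<Longrightarrow> (h has_field_derivative h1 z) (at z)"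
           "\<And>z. z \<in> S \<Longrightarrow> (h1 has_field_derivative h2 z) (at z)" "continuous_on S h2"
    and g: "\<And>z. z \<in> S \<Longrightarrow> (g has_field_derivative g1 z) (at z)"
           "\<And>z. z \<in> S \<Longrightarrow> (g1 has_field_derivative g2 z) (at z)" "continuous_on S g2"
    and f: "\<And>z. z \<in> S \<Longrightarrow> f z = h z + cnj (g z)"
  shows "harmonic_on f S"
proof -
  have partials: "((\<lambda>z. H z + cnj (G z)) has_derivative
      (\<lambda>w. Re w *\<^sub>R (H' z + cnj (G' z)) + Im w *\<^sub>R (\<i> * H' z + cnj (\<i> * G' z)))) (at z)"
    if "(H has_field_derivative H' z) (at z)" "(G has_field_derivative G' z) (at z)" for H G H' G' z
  proof -
    have "H' z * w + cnj (G' z * w) =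
        Re w *\<^sub>R (H' z + cnj (G' z)) + Im w *\<^sub>R (\<i> * H' z + cnj (\<i> * G' z))" for w
      by (simp add: complex_eq_iff algebra_simps)
    thus ?thesis using has_derivative_add_cnj[OF that] by simp
  qed
  have f': "(f has_derivative
      (\<lambda>w. Re w *\<^sub>R (h1 z + cnj (g1 z)) + Im w *\<^sub>R (\<i> * h1 z + cnj (\<i> * g1 z)))) (at z)"
    if "z \<in> S" for z
    by (rule has_derivative_transform_within_open[OF partials[where H = h and H' = h1 and G = g and G' = g1] S that])
       (use h g f that in auto)
  have i: "((\<lambda>z. \<i> * k z) has_field_derivative \<i> * k') (at z)"
    if "(k has_field_derivative k') (at z)" for k k' z
    using that by (rule DERIV_cmult)
  have "\<i> * (\<i> * h2 z) + cnj (\<i> * (\<i> * g2 z)) = - (h2 z + cnj (g2 z))" for z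
    by (simp flip: mult.assoc)
  hence laplace: "(h2 z + cnj (g2 z)) + (\<i> * (\<i> * h2 z) + cnj (\<i> * (\<i> * g2 z))) = 0" for z
    by simp
  show ?thesis
    unfolding harmonic_on_def
  proof (intro conjI exI ballI)
    fix z assume z: "z \<in> S"
    show "(f has_derivative
      (\<lambda>w. Re w *\<^sub>R (h1 z + cnj (g1 z)) + Im w *\<^sub>R (\<i> * h1 z + cnj (\<i> * g1 z)))) (at z)"
      by (rule f'[OF z])
    show "((\<lambda>z. h1 z + cnj (g1 z)) has_derivative
      (\<lambda>w. Re w *\<^sub>R (h2 z + cnj (g2 z)) + Im w *\<^sub>R (\<i> * h2 z + cnj (\<i> * g2 z)))) (at z)"
      by (rule partials[where H = h1 and H' = h2 and G = g1 and G' = g2, OF h(2)[OF z] g(2)[OF z]])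
    show "((\<lambda>z. \<i> * h1 z + cnj (\<i> * g1 z)) has_derivative
      (\<lambda>w. Re w *\<^sub>R (\<i> * h2 z + cnj (\<i> * g2 z)) + Im w *\<^sub>R (\<i> * (\<i> * h2 z) + cnj (\<i> * (\<i> * g2 z))))) (at z)"
      by (rule partials[where H' = "\<lambda>z. \<i> * h2 z" and G' = "\<lambda>z. \<i> * g2 z",
            OF i[OF h(2)[OF z]] i[OF g(2)[OF z]]])
    show "h2 z + cnj (g2 z) + (\<i> * (\<i> * h2 z) + cnj (\<i> * (\<i> * g2 z))) = 0" by (rule laplace)
  qed (use S h(3) g(3) in \<open>auto intro!: continuous_intros continuous_on_cnj\<close>)
qed

text \<open>
  Along a segment with direction \<open>d\<close> the component of \<open>f\<close> in the direction \<open>d\<close> has derivative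
  at least \<open>\<bar>d\<bar>\<^sup>2 (1 - \<bar>p - 1\<bar> - \<bar>q\<bar>) > 0\<close>, so the end points have different images.
\<close>
lemma inj_on_if_derivative_near_identity:
  fixes f :: "complex \<Rightarrow> complex"
  assumes "convex S"
    and f: "\<And>z. z \<in> S \<Longrightarrow> (f has_derivative (\<lambda>w. p z * w + cnj (q z * w))) (at z)"
    and near: "\<And>z. z \<in> S \<Longrightarrow> cmod (p z - 1) + cmod (q z) < 1"
  shows "inj_on f S"
proof (rule inj_onI, rule ccontr)
  fix a b assume ab: "a \<in> S" "b \<in> S" "f a = f b" "a \<noteq> b"
  define d where "d = b - a"
  define \<gamma> where "\<gamma> t = a + of_real t * d" for t :: real
  have "0 < cmod d" using ab by (simp add: d_def)
  have "d \<bullet> f (\<gamma> 0) < d \<bullet> f (\<gamma> 1)"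
  proof (rule DERIV_pos_imp_increasing[of 0 1 "\<lambda>t. d \<bullet> f (\<gamma> t)"])
    fix t :: real assume t: "0 \<le> t" "t \<le> 1"
    have "\<gamma> t = (1 - t) *\<^sub>R a + t *\<^sub>R b"
      by (simp add: \<gamma>_def d_def scaleR_conv_of_real algebra_simps)
    hence S: "\<gamma> t \<in> S" using \<open>convex S\<close> ab t by (simp add: convex_alt)
    define P Q where "P = p (\<gamma> t)" and "Q = q (\<gamma> t)"
    have "(\<gamma> has_vector_derivative d) (at t)"
      unfolding \<gamma>_def by (auto intro!: derivative_eq_intros)
    from diff_chain_at[OF this[unfolded has_vector_derivative_def] f[OF S]]
    have "((f \<circ> \<gamma>) has_derivative (\<lambda>w. P * w + cnj (Q * w)) \<circ> (\<lambda>s. s *\<^sub>R d)) (at t)"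
      by (simp add: P_def Q_def)
    also have "(\<lambda>w. P * w + cnj (Q * w)) \<circ> (\<lambda>s. s *\<^sub>R d) = (\<lambda>s. s *\<^sub>R (P * d + cnj (Q * d)))"
      by (simp add: fun_eq_iff scaleR_right_distrib)
    finally have "((f \<circ> \<gamma>) has_vector_derivative (P * d + cnj (Q * d))) (at t)"
      by (simp only: has_vector_derivative_def)
    hence "((\<lambda>t. d \<bullet> f (\<gamma> t)) has_real_derivative d \<bullet> (P * d + cnj (Q * d))) (at t)"
      unfolding has_real_derivative_iff_has_vector_derivative
      using bounded_linear.has_vector_derivative[OF bounded_linear_inner_right] by (fastforce simp: o_def)
    moreover have "d \<bullet> (P * d + cnj (Q * d)) > 0"
    proof -
      have "d \<bullet> ((1 - P) * d - cnj (Q * d)) \<le> cmod d * cmod ((1 - P) * d - cnj (Q * d))"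
        by (rule norm_cauchy_schwarz)
      also have "\<dots> \<le> cmod d * (cmod ((1 - P) * d) + cmod (cnj (Q * d)))"
        by (intro mult_left_mono norm_triangle_ineq4) auto
      also have "\<dots> = (cmod (P - 1) + cmod Q) * (cmod d)\<^sup>2"
        unfolding norm_mult complex_mod_cnj norm_minus_commute[of P 1] power2_eq_square
        by (simp add: algebra_simps)
      also have "\<dots> < 1 * (cmod d)\<^sup>2"
        using near[OF S] \<open>0 < cmod d\<close> by (intro mult_strict_right_mono) (auto simp: P_def Q_def)
      also have "\<dots> = d \<bullet> d" by (simp add: power2_norm_eq_inner)
      finally show ?thesis by (simp add: algebra_simps inner_diff_right inner_add_right)
    qed
    ultimately show "\<exists>y. ((\<lambda>t. d \<bullet> f (\<gamma> t)) has_real_derivative y) (at t) \<and> y > 0" by blast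
  qed simp
  thus False using ab by (simp add: \<gamma>_def d_def)
qed

section \<open>Power series with linearly growing coefficients\<close>

definition powser :: "(nat \<Rightarrow> complex) \<Rightarrow> complex \<Rightarrow> complex" where
  "powser c z = (\<Sum>n. c n * z ^ n)"

lemma summable_if_linear_growth:
  fixes z :: complex
  assumes "\<And>n. cmod (c n) \<le> real n + 1" "cmod z < 1"
  shows "summable (\<lambda>n. c n * z ^ n)"
proof (rule summable_comparison_test')
  show "summable (\<lambda>n. real (Suc n) * cmod z ^ n)"
    using geometric_deriv_sums[of "cmod z"] assms(2) by (simp add: sums_iff)
  show "norm (c n * z ^ n) \<le> real (Suc n) * cmod z ^ n" for n
    using assms(1)[of n] by (auto simp: norm_mult norm_power intro!: mult_right_mono)
qed

lemma powser_derivative: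
  assumes "\<And>z. cmod z < 1 \<Longrightarrow> summable (\<lambda>n. c n * z ^ n)" "cmod z < 1"
  shows "(powser c has_field_derivative powser (diffs c) z) (at z)"
  unfolding powser_def[abs_def] using assms by (rule termdiffs_strong')

lemma powser_eq_shifted:
  assumes "summable (\<lambda>n. c n * z ^ n)"
  shows "powser c z = c 0 + (\<Sum>n. c (n + 1) * z ^ (n + 1))"
  using suminf_split_initial_segment[OF assms, of 1] by (simp add: powser_def)

lemma powser_eq_shifted_twice:
  assumes "summable (\<lambda>n. c n * z ^ n)"
  shows "powser c z = c 0 + c 1 * z + (\<Sum>n. c (n + 2) * z ^ (n + 2))"
  using suminf_split_initial_segment[OF assms, of 2] by (simp add: powser_def lessThan_nat_numeral)

text \<open>
  Differentiating \<open>\<Sum>n. (n + 1) x\<^sup>n = 1 / (1 - x)\<^sup>2\<close> twice gives the generating functions of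
  \<open>(n + 1) (n + 2)\<close> and \<open>(n + 1) (n + 2) (n + 3)\<close>; the cubes are a linear combination of the three.
\<close>
lemma cubes_power_sums:
  fixes r :: real
  assumes "\<bar>r\<bar> < 1"
  shows "(\<lambda>n. (real n + 1)^3 * r^n) sums ((r^2 + 4 * r + 1) / (1 - r)^4)"
proof -
  have s1: "(\<lambda>n. real (Suc n) * x^n) sums (1 / (1 - x)^2)" if "norm x < 1" for x :: real
    using geometric_deriv_sums[of x] that by simp
  have s2: "(\<lambda>n. diffs (\<lambda>n. real (Suc n)) n * x^n) sums (2 / (1 - x)^3)" if "norm x < 1" for x :: real
  proof (rule termdiffs_sums_strong[OF s1 _ that])
    show "((\<lambda>x. 1 / (1 - x)^2) has_real_derivative 2 / (1 - x)^3) (at x)"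
      using that by (auto intro!: derivative_eq_intros simp: divide_simps eval_nat_numeral)
  qed simp
  have s3: "(\<lambda>n. diffs (diffs (\<lambda>n. real (Suc n))) n * r^n) sums (6 / (1 - r)^4)"
  proof (rule termdiffs_sums_strong[OF s2])
    show "((\<lambda>x. 2 / (1 - x)^3) has_real_derivative 6 / (1 - r)^4) (at r)"
      using assms by (auto intro!: derivative_eq_intros simp: divide_simps eval_nat_numeral) (simp add: algebra_simps)
  qed (use assms in auto)
  have "(\<lambda>n. diffs (diffs (\<lambda>n. real (Suc n))) n * r^n - 3 * (diffs (\<lambda>n. real (Suc n)) n * r^n)
          + real (Suc n) * r^n) sums (6 / (1 - r)^4 - 3 * (2 / (1 - r)^3) + 1 / (1 - r)^2)"
    using assms by (intro sums_add sums_diff sums_mult s1 s2 s3) auto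
  also have "(\<lambda>n. diffs (diffs (\<lambda>n. real (Suc n))) n * r^n - 3 * (diffs (\<lambda>n. real (Suc n)) n * r^n)
          + real (Suc n) * r^n) = (\<lambda>n. (real n + 1)^3 * r^n)"
    by (rule ext) (simp add: diffs_def algebra_simps eval_nat_numeral)
  also have "6 / (1 - r)^4 - 3 * (2 / (1 - r)^3) + 1 / (1 - r)^2 = (r^2 + 4 * r + 1) / (1 - r)^4"
  proof -
    have "r^2 + 4 * r + 1 = 6 - 6 * (1 - r) + (1 - r)^2"
      by (simp add: power2_eq_square algebra_simps)
    moreover have "6 / x^4 - 3 * (2 / x^3) + 1 / x^2 = (6 - 6 * x + x^2) / x^4" if "x \<noteq> 0" for x :: real
      using that by (simp add: field_simps eval_nat_numeral)
    ultimately show ?thesis using assms by simp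
  qed
  finally show ?thesis .
qed

text \<open>
  At \<open>Suc n\<close> the first factor is at most \<open>3 (n + 2)\<close> and the other two are at most \<open>n + 2\<close>, so the series
  of cubes dominates.
\<close>
lemma weighted_majorant_summable:
  fixes k :: "nat \<Rightarrow> real" and \<mu> r :: real
  assumes k: "\<And>n. 0 \<le> k n" "\<And>n. k n \<le> real n + 1"
    and \<mu>: "\<bar>\<mu>\<bar> \<le> 2" and r: "0 \<le> r" "r < 1"
  shows "summable (\<lambda>n. (real (Suc n) + 1 + \<mu>) * (real (Suc n) + 1) * k (Suc n) * r ^ Suc n)"
proof (rule summable_comparison_test')
  have "summable (\<lambda>n. (real n + 1)^3 * r ^ n)"
    using cubes_power_sums[of r] r by (simp add: sums_iff)
  thus "summable (\<lambda>n. 3 * ((real (Suc n) + 1)^3 * r ^ Suc n))"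
    by (intro summable_mult) (subst summable_Suc_iff)
  fix n
  let ?m = "(real (Suc n) + 1 + \<mu>) * (real (Suc n) + 1) * k (Suc n) * r ^ Suc n"
  have "0 \<le> ?m" using \<mu> k(1) r by (intro mult_nonneg_nonneg) auto
  hence "norm ?m = ?m" by (simp only: real_norm_def abs_of_nonneg)
  also have "\<dots> \<le> (3 * (real (Suc n) + 1)) * (real (Suc n) + 1) * (real (Suc n) + 1) * r ^ Suc n"
    using \<mu> k(1) k(2)[of "Suc n"] r by (intro mult_right_mono mult_mono) auto
  finally show "norm ?m \<le> 3 * ((real (Suc n) + 1)^3 * r ^ Suc n)"
    by (simp only: power3_eq_cube mult_ac)
qed

text \<open>
  For \<open>k(z) = \<Sum>n. c\<^sub>n z\<^sup>n\<close>, the combination \<open>z k'' + (1 + \<mu>) k'\<close> is the power series of \<open>k'\<close> with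
  its \<open>n\<close>-th coefficient multiplied by \<open>n + 1 + \<mu>\<close>. For \<open>\<mu> \<ge> -2\<close> these weights are nonnegative from
  \<open>n = 1\<close> on, so the majorant needs no absolute values around them and stays a polynomial in \<open>n\<close>;
  only the constant term is split off.
\<close>
lemma weighted_tail_bound:
  fixes c :: "nat \<Rightarrow> complex" and k :: "nat \<Rightarrow> real" and \<mu> :: real
  assumes c: "\<And>n. cmod (c n) \<le> real n + 1" "\<And>n. cmod (c (Suc n)) \<le> k n"
    and k: "\<And>n. k n \<le> real n + 1"
    and \<mu>: "\<bar>\<mu>\<bar> \<le> 2" and z: "cmod z < 1"
  defines "m \<equiv> \<lambda>n. (real n + 1 + \<mu>) * (real n + 1) * k n * cmod z ^ n"
  shows "cmod (z * powser (diffs (diffs c)) z + of_real (1 + \<mu>) * powser (diffs c) z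
           - of_real (1 + \<mu>) * c 1) \<le> (\<Sum>n. m (Suc n))"
proof -
  define T where "T n = of_real (real n + 1 + \<mu>) * diffs c n * z ^ n" for n
  have s1: "summable (\<lambda>n. diffs c n * z ^ n)" if "cmod z < 1" for z
    using termdiff_converges[of z 1 c] that summable_if_linear_growth[OF c(1)] by blast
  have s2: "summable (\<lambda>n. diffs (diffs c) n * z ^ n)"
    using termdiff_converges[of z 1 "diffs c"] z s1 by blast
  have "(\<lambda>n. of_nat (Suc n) * diffs c (Suc n) * z ^ Suc n) sums (z * powser (diffs (diffs c)) z)"
    using sums_mult[OF summable_sums[OF s2], of z] by (simp add: powser_def diffs_def algebra_simps)
  hence "(\<lambda>n. of_nat n * diffs c n * z ^ n) sums (z * powser (diffs (diffs c)) z)"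
    by (subst (asm) sums_Suc_iff) simp
  from sums_add[OF this sums_mult[OF summable_sums[OF s1[OF z]], of "of_real (1 + \<mu>)"]]
  have T: "T sums (z * powser (diffs (diffs c)) z + of_real (1 + \<mu>) * powser (diffs c) z)"
    by (simp add: powser_def T_def[abs_def] algebra_simps)
  have "(\<lambda>n. T (Suc n)) sums (z * powser (diffs (diffs c)) z + of_real (1 + \<mu>) * powser (diffs c) z - T 0)"
    using T by (subst sums_Suc_iff) simp
  hence tail: "(\<Sum>n. T (Suc n)) = z * powser (diffs (diffs c)) z + of_real (1 + \<mu>) * powser (diffs c) z
      - of_real (1 + \<mu>) * c 1"
    by (simp add: sums_iff T_def diffs_def)
  have bound: "norm (T (Suc n)) \<le> m (Suc n)" for n
  proof -
    have "real (Suc n) + 1 + \<mu> \<ge> 0" using \<mu> by auto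
    hence "norm (T (Suc n)) = (real (Suc n) + 1 + \<mu>) * (real (Suc n) + 1) * cmod (c (Suc (Suc n))) * cmod z ^ Suc n"
      unfolding T_def diffs_def norm_mult norm_power norm_of_real norm_of_nat by simp
    also have "\<dots> \<le> m (Suc n)"
      unfolding m_def using c(2)[of "Suc n"] \<open>real (Suc n) + 1 + \<mu> \<ge> 0\<close>
      by (intro mult_right_mono mult_left_mono) auto
    finally show ?thesis .
  qed
  have "0 \<le> k n" for n using order_trans[OF norm_ge_zero c(2)] .
  hence m: "summable (\<lambda>n. m (Suc n))"
    unfolding m_def using k \<mu> z by (intro weighted_majorant_summable) auto
  show "cmod (z * powser (diffs (diffs c)) z + of_real (1 + \<mu>) * powser (diffs c) z
           - of_real (1 + \<mu>) * c 1) \<le> (\<Sum>n. m (Suc n))"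
    unfolding tail[symmetric] by (rule norm_suminf_le[OF bound m])
qed

text \<open>
  The four summands are the perturbations of the \<open>h\<close> and \<open>g\<close> parts of \<open>A + (1 - \<alpha>) B\<close> (first two)
  and of \<open>A - (1 + \<alpha>) B\<close> (last two), after division by \<open>\<bar>z\<bar>\<close>. Their majorants have weights
  \<open>n + 1 + \<mu>\<close> with \<open>\<mu> = 1 - \<alpha>, \<alpha> - 1, -1 - \<alpha>, 1 + \<alpha>\<close>. Each is awkward, but their sum collapses to
  \<open>2 ((n + 1)\<^sup>3 - \<alpha> (n + 1)) r\<^sup>n\<close>, and it is this sum that the defining equation of \<open>r_C\<close> controls.
\<close>
lemma total_error_bound:
  fixes a b :: "nat \<Rightarrow> complex"
  assumes \<alpha>: "0 \<le> \<alpha>" "\<alpha> < 1"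
    and a: "a 0 = 0" "a 1 = 1" "\<And>n. n \<ge> 1 \<Longrightarrow> cmod (a n) \<le> (real n + 1) / 2"
    and b: "b 0 = 0" "\<And>n. n \<ge> 1 \<Longrightarrow> cmod (b n) \<le> (real n - 1) / 2"
    and z: "cmod z < r_C \<alpha>"
  defines "h1 \<equiv> powser (diffs a) z" and "h2 \<equiv> powser (diffs (diffs a)) z"
    and "g1 \<equiv> powser (diffs b) z" and "g2 \<equiv> powser (diffs (diffs b)) z"
  shows "cmod (z * h2 + of_real (2 - \<alpha>) * h1 - of_real (2 - \<alpha>))
       + cmod (z * g2 + of_real \<alpha> * g1)
       + cmod (z * h2 - of_real \<alpha> * h1 + of_real \<alpha>)
       + cmod (z * g2 + of_real (2 + \<alpha>) * g1) < 2 * (1 - \<alpha>)"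
proof -
  define r where "r = cmod z"
  have r: "0 \<le> r" "r < 1"
    using z rC_root_r_C[OF \<alpha>] by (auto simp: r_def rC_root_def)
  define m where "m \<mu> k n = (real n + 1 + \<mu>) * (real n + 1) * k n * r ^ n" for \<mu> :: real and k :: "nat \<Rightarrow> real" and n
  let ?p = "\<lambda>n. (real n + 2) / 2" and ?q = "\<lambda>n. real n / 2"
  have a': "cmod (a n) \<le> real n + 1" "cmod (a (Suc n)) \<le> (real n + 2) / 2" for n
    using a(1) a(3)[of n] a(3)[of "Suc n"] by (cases "n = 0"; simp)+
  have b': "cmod (b n) \<le> real n + 1" "cmod (b (Suc n)) \<le> real n / 2" for n
    using b(1) b(2)[of n] b(2)[of "Suc n"] by (cases "n = 0"; simp)+
  have z1: "cmod z < 1" using r by (simp add: r_def)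
  have b1: "b 1 = 0" using b(2)[of 1] by simp
  have k: "(real n + 2) / 2 \<le> real n + 1" "real n / 2 \<le> real n + 1" for n by simp_all
  have sum_p: "summable (\<lambda>n. m \<mu> ?p (Suc n))" if "\<bar>\<mu>\<bar> \<le> 2" for \<mu>
    unfolding m_def by (rule weighted_majorant_summable[OF _ k(1) that r]) simp
  have sum_q: "summable (\<lambda>n. m \<mu> ?q (Suc n))" if "\<bar>\<mu>\<bar> \<le> 2" for \<mu>
    unfolding m_def by (rule weighted_majorant_summable[OF _ k(2) that r]) simp
  have bound_a: "cmod (z * h2 + of_real (1 + \<mu>) * h1 - of_real (1 + \<mu>)) \<le> (\<Sum>n. m \<mu> ?p (Suc n))"
    if "\<bar>\<mu>\<bar> \<le> 2" for \<mu>
    using weighted_tail_bound[where c = a and k = ?p, OF a' k(1) that z1]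
    by (simp only: m_def r_def h1_def h2_def a(2) mult_1_right)
  have bound_b: "cmod (z * g2 + of_real (1 + \<mu>) * g1) \<le> (\<Sum>n. m \<mu> ?q (Suc n))"
    if "\<bar>\<mu>\<bar> \<le> 2" for \<mu>
    using weighted_tail_bound[where c = b and k = ?q, OF b' k(2) that z1]
    by (simp only: m_def r_def g1_def g2_def b1 mult_zero_right diff_zero)
  have \<mu>: "\<bar>1 - \<alpha>\<bar> \<le> 2" "\<bar>- 1 - \<alpha>\<bar> \<le> 2" "\<bar>\<alpha> - 1\<bar> \<le> 2" "\<bar>1 + \<alpha>\<bar> \<le> 2"
    using \<alpha> by (simp_all add: abs_le_iff)
  have shift: "1 + (1 - \<alpha>) = 2 - \<alpha>" "1 + (- 1 - \<alpha>) = - \<alpha>" "1 + (\<alpha> - 1) = \<alpha>" "1 + (1 + \<alpha>) = 2 + \<alpha>"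
    by simp_all
  have e1: "cmod (z * h2 + of_real (2 - \<alpha>) * h1 - of_real (2 - \<alpha>)) \<le> (\<Sum>n. m (1 - \<alpha>) ?p (Suc n))"
    using bound_a[OF \<mu>(1)] unfolding shift .
  have e2: "cmod (z * g2 + of_real \<alpha> * g1) \<le> (\<Sum>n. m (\<alpha> - 1) ?q (Suc n))"
    using bound_b[OF \<mu>(3)] unfolding shift .
  have e3: "cmod (z * h2 - of_real \<alpha> * h1 + of_real \<alpha>) \<le> (\<Sum>n. m (- 1 - \<alpha>) ?p (Suc n))"
    using bound_a[OF \<mu>(2)] unfolding shift by simp
  have e4: "cmod (z * g2 + of_real (2 + \<alpha>) * g1) \<le> (\<Sum>n. m (1 + \<alpha>) ?q (Suc n))"
    using bound_b[OF \<mu>(4)] unfolding shift .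
  note sm = sum_p[OF \<mu>(1)] sum_p[OF \<mu>(2)] sum_q[OF \<mu>(3)] sum_q[OF \<mu>(4)]
  define U where "U n = 2 * ((real n + 1)^3 * r ^ n - \<alpha> * (real (Suc n) * r ^ n))" for n
  have "U sums (2 * ((r^2 + 4 * r + 1) / (1 - r)^4 - \<alpha> * (1 / (1 - r)^2)))"
    unfolding U_def using r geometric_deriv_sums[of r] 
    by (intro sums_mult sums_diff cubes_power_sums) auto
  hence U: "(\<lambda>n. U (Suc n)) sums (2 * ((r^2 + 4 * r + 1) / (1 - r)^4 - \<alpha> * (1 / (1 - r)^2)) - U 0)"
    by (subst sums_Suc_iff) simp
  have mU: "m (1 - \<alpha>) ?p n + m (\<alpha> - 1) ?q n + m (- 1 - \<alpha>) ?p n + m (1 + \<alpha>) ?q n = U n" for n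
    by (simp add: m_def U_def power3_eq_cube field_simps)
  have "(\<lambda>n. U (Suc n)) sums ((\<Sum>n. m (1 - \<alpha>) ?p (Suc n)) + (\<Sum>n. m (\<alpha> - 1) ?q (Suc n))
      + (\<Sum>n. m (- 1 - \<alpha>) ?p (Suc n)) + (\<Sum>n. m (1 + \<alpha>) ?q (Suc n)))"
    unfolding mU[symmetric] by (intro sums_add summable_sums sm)
  from sums_unique2[OF this U] e1 e2 e3 e4
  have "cmod (z * h2 + of_real (2 - \<alpha>) * h1 - of_real (2 - \<alpha>))
       + cmod (z * g2 + of_real \<alpha> * g1)
       + cmod (z * h2 - of_real \<alpha> * h1 + of_real \<alpha>)
       + cmod (z * g2 + of_real (2 + \<alpha>) * g1) 
      \<le> 2 * ((r^2 + 4 * r + 1) / (1 - r)^4 - \<alpha> / (1 - r)^2) - 2 * (1 - \<alpha>)"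
    by (simp add: U_def)
  also have "\<dots> < 2 * (1 - \<alpha>)"
  proof -
    have "(r^2 + 4 * r + 1) / (1 - r)^4 < (2 * (1 - \<alpha>) * (1 - r)^4 + \<alpha> * (1 - r)^2) / (1 - r)^4"
      using rC_polynomial_pos[OF \<alpha>, of r] z r by (intro divide_strict_right_mono) (auto simp: r_def)
    also have "\<dots> = 2 * (1 - \<alpha>) + \<alpha> / (1 - r)^2"
      using r by (simp add: add_divide_distrib power2_eq_square eval_nat_numeral)
    finally show ?thesis unfolding right_diff_distrib by linarith
  qed
  finally show ?thesis .
qed

section \<open>Turning of the image circles\<close>

text \<open>
  \<open>A/B\<close> is nearer to \<open>1 + \<alpha>\<close> than to \<open>\<alpha> - 1\<close>, and the perpendicular bisector of these two points is
  the line \<open>Re = \<alpha>\<close>.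
\<close>
lemma Re_divide_gt_if_norms:
  fixes A B :: complex
  assumes "cmod (A - of_real (1 + \<alpha>) * B) < cmod (A + of_real (1 - \<alpha>) * B)" "B \<noteq> 0"
  shows "Re (A / B) > \<alpha>"
proof -
  have "(cmod (A - of_real (1 + \<alpha>) * B))\<^sup>2 < (cmod (A + of_real (1 - \<alpha>) * B))\<^sup>2"
    using assms by (intro power_strict_mono) auto
  hence "\<alpha> * ((Re B)\<^sup>2 + (Im B)\<^sup>2) < Re A * Re B + Im A * Im B"
    unfolding cmod_power2 by (simp add: power2_eq_square algebra_simps)
  moreover have "(Re B)\<^sup>2 + (Im B)\<^sup>2 > 0" using assms(2) by (simp add: complex_neq_0)
  ultimately show ?thesis by (simp add: Re_divide pos_less_divide_eq)
qed

text \<open>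
  The numbers \<open>h1, h2, g1, g2\<close> stand for \<open>h', h'', g', g''\<close> at \<open>z\<close>. The bound on the
  errors suffices, because \<open>2 (h1 - 1)\<close> and \<open>2 g1\<close> are differences of two of the four error terms each.
\<close>
lemma near_identity_if_small_errors:
  fixes z h1 h2 g1 g2 :: complex
  assumes \<alpha>: "0 \<le> \<alpha>" "\<alpha> < 1"
    and err: "cmod (z * h2 + of_real (2 - \<alpha>) * h1 - of_real (2 - \<alpha>))
       + cmod (z * g2 + of_real \<alpha> * g1)
       + cmod (z * h2 - of_real \<alpha> * h1 + of_real \<alpha>)
       + cmod (z * g2 + of_real (2 + \<alpha>) * g1) < 2 * (1 - \<alpha>)"
  shows "cmod (h1 - 1) + cmod g1 < 1"
proof -
  define E1 E2 E3 E4 where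
    "E1 = z * h2 + of_real (2 - \<alpha>) * h1 - of_real (2 - \<alpha>)" and
    "E2 = z * g2 + of_real \<alpha> * g1" and
    "E3 = z * h2 - of_real \<alpha> * h1 + of_real \<alpha>" and
    "E4 = z * g2 + of_real (2 + \<alpha>) * g1"
  have err': "cmod E1 + cmod E2 + cmod E3 + cmod E4 < 2 * (1 - \<alpha>)"
    using err by (simp add: E1_def E2_def E3_def E4_def)
  have "E1 - E3 = 2 * (h1 - 1)" "E4 - E2 = 2 * g1"
    by (simp_all add: E1_def E2_def E3_def E4_def algebra_simps)
  hence "cmod (E1 - E3) = 2 * cmod (h1 - 1)" "cmod (E4 - E2) = 2 * cmod g1"
    by (simp_all only: norm_mult norm_numeral)
  moreover have "cmod E1 + cmod E2 + cmod E3 + cmod E4 < 2" using err' \<alpha> by simp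
  ultimately show ?thesis
    using norm_triangle_ineq4[of E1 E3] norm_triangle_ineq4[of E4 E2] by linarith
qed

text \<open>
  Numerator and denominator are \<open>A\<close> and \<open>B\<close>. The errors, multiplied by \<open>\<bar>z\<bar>\<close>, give a lower bound for
  \<open>\<bar>A + (1 - \<alpha>) B\<bar>\<close> that exceeds an upper bound for \<open>\<bar>A - (1 + \<alpha>) B\<bar>\<close>; closeness of \<open>h1\<close> to \<open>1\<close> and
  smallness of \<open>g1\<close> keep \<open>B\<close> away from \<open>0\<close>.
\<close>
lemma turning_if_small_errors:
  fixes z h1 h2 g1 g2 :: complex
  assumes \<alpha>: "0 \<le> \<alpha>" "\<alpha> < 1"
    and z: "z \<noteq> 0"
    and err: "cmod (z * h2 + of_real (2 - \<alpha>) * h1 - of_real (2 - \<alpha>))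
       + cmod (z * g2 + of_real \<alpha> * g1)
       + cmod (z * h2 - of_real \<alpha> * h1 + of_real \<alpha>)
       + cmod (z * g2 + of_real (2 + \<alpha>) * g1) < 2 * (1 - \<alpha>)"
  shows "Re ((z * (h1 + z * h2) + cnj (z * (g1 + z * g2))) / (z * h1 - cnj (z * g1))) > \<alpha>"
proof -
  have near: "cmod (h1 - 1) + cmod g1 < 1" by (rule near_identity_if_small_errors[OF \<alpha> err])
  define E1 E2 E3 E4 where
    "E1 = z * h2 + of_real (2 - \<alpha>) * h1 - of_real (2 - \<alpha>)" and
    "E2 = z * g2 + of_real \<alpha> * g1" and
    "E3 = z * h2 - of_real \<alpha> * h1 + of_real \<alpha>" and
    "E4 = z * g2 + of_real (2 + \<alpha>) * g1"
  have err': "cmod E1 + cmod E2 + cmod E3 + cmod E4 < 2 * (1 - \<alpha>)"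
    using err by (simp add: E1_def E2_def E3_def E4_def)
  define A B where "A = z * (h1 + z * h2) + cnj (z * (g1 + z * g2))" and "B = z * h1 - cnj (z * g1)"
  have "B \<noteq> 0"
  proof
    assume "B = 0"
    hence "cmod (z * h1) = cmod (cnj (z * g1))" by (simp add: B_def)
    hence "cmod z * cmod h1 = cmod z * cmod g1" by (simp only: norm_mult complex_mod_cnj)
    thus False using z near norm_triangle_ineq2[of 1 "1 - h1"] by (simp add: norm_minus_commute)
  qed
  have plus: "A + of_real (1 - \<alpha>) * B = of_real (2 - \<alpha>) * z - (- (z * E1) - cnj (z * E2))"
    by (simp add: A_def B_def E1_def E2_def algebra_simps)
  have minus: "A - of_real (1 + \<alpha>) * B = (z * E3 + cnj (z * E4)) - of_real \<alpha> * z"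
    by (simp add: A_def B_def E3_def E4_def algebra_simps)
  have "cmod (A - of_real (1 + \<alpha>) * B) \<le> cmod z * cmod E3 + cmod z * cmod E4 + \<alpha> * cmod z"
    unfolding minus using norm_triangle_ineq4[of "z * E3 + cnj (z * E4)" "of_real \<alpha> * z"]
      norm_triangle_ineq[of "z * E3" "cnj (z * E4)"] \<alpha> by (simp add: norm_mult)
  also have "\<dots> = cmod z * (cmod E3 + cmod E4 + \<alpha>)" by (simp add: algebra_simps)
  also have "\<dots> < cmod z * ((2 - \<alpha>) - cmod E1 - cmod E2)"
    using err' z by (intro mult_strict_left_mono) auto
  also have "\<dots> = (2 - \<alpha>) * cmod z - (cmod z * cmod E1 + cmod z * cmod E2)" by (simp add: algebra_simps)
  also have "\<dots> \<le> cmod (A + of_real (1 - \<alpha>) * B)"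
    unfolding plus using norm_triangle_ineq2[of "of_real (2 - \<alpha>) * z" "- (z * E1) - cnj (z * E2)"]
      norm_triangle_ineq4[of "- (z * E1)" "cnj (z * E2)"] \<alpha> by (simp add: norm_mult del: of_real_diff)
  finally have "Re (A / B) > \<alpha>" using \<open>B \<noteq> 0\<close> by (rule Re_divide_gt_if_norms)
  thus ?thesis
    by (simp add: A_def B_def)
qed

text \<open>
  The pointwise bounds hold at every point of the disk. The first gives injectivity; on each circle it
  also keeps the velocity within a right angle of \<open>\<i> e\<^sup>i\<^sup>t\<close>, and the second bounds the turning rate from below.
  These are the hypotheses of the lemma on locally strictly convex curves.
\<close>
lemma univalent_and_fully_convex:
  fixes \<alpha> :: real and a b :: "nat \<Rightarrow> complex" and f :: "complex \<Rightarrow> complex"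
  assumes \<alpha>: "0 \<le> \<alpha>" "\<alpha> < 1"
    and a: "a 0 = 0" "a 1 = 1" "\<And>n. n \<ge> 1 \<Longrightarrow> cmod (a n) \<le> (real n + 1) / 2"
    and b: "b 0 = 0" "\<And>n. n \<ge> 1 \<Longrightarrow> cmod (b n) \<le> (real n - 1) / 2"
    and f: "\<And>z. cmod z < 1 \<Longrightarrow> f z = powser a z + cnj (powser b z)"
  shows "inj_on f (ball 0 (r_C \<alpha>)) \<and> fully_convex_of_order \<alpha> f (r_C \<alpha>)"
proof -
  define h h1 h2 where "h = powser a" and "h1 = powser (diffs a)" and "h2 = powser (diffs (diffs a))"
  define g g1 g2 where "g = powser b" and "g1 = powser (diffs b)" and "g2 = powser (diffs (diffs b))"
  have R: "0 < r_C \<alpha>" "r_C \<alpha> < 1" using rC_root_r_C[OF \<alpha>] by (auto simp: rC_root_def)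
  have growth: "cmod (a n) \<le> real n + 1" "cmod (b n) \<le> real n + 1" for n
    using a(1) a(3)[of n] b(1) b(2)[of n] by (cases "n = 0"; simp)+
  have derivs: "(powser c has_field_derivative powser (diffs c) z) (at z)"
    "(powser (diffs c) has_field_derivative powser (diffs (diffs c)) z) (at z)"
    "isCont (powser (diffs (diffs c))) z"
    if c: "\<And>n. cmod (c n) \<le> real n + 1" and z: "cmod z < 1" for c z
  proof -
    have s: "summable (\<lambda>n. c n * z ^ n)" if "cmod z < 1" for z
      by (rule summable_if_linear_growth[OF c that])
    have s1: "summable (\<lambda>n. diffs c n * z ^ n)" if "cmod z < 1" for z
      by (rule termdiff_converges[OF that s])
    have s2: "summable (\<lambda>n. diffs (diffs c) n * z ^ n)" if "cmod z < 1" for z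
      by (rule termdiff_converges[OF that s1])
    show "(powser c has_field_derivative powser (diffs c) z) (at z)"
      by (rule powser_derivative[OF s z])
    show "(powser (diffs c) has_field_derivative powser (diffs (diffs c)) z) (at z)"
      by (rule powser_derivative[OF s1 z])
    show "isCont (powser (diffs (diffs c))) z"
      by (rule DERIV_isCont[OF powser_derivative[OF s2 z]])
  qed
  note dh = derivs[OF growth(1), folded h_def h1_def h2_def]
  note dg = derivs[OF growth(2), folded g_def g1_def g2_def]
  have f': "f z = h z + cnj (g z)" if "cmod z < 1" for z using f[OF that] by (simp add: h_def g_def)

  have pointwise: "cmod (h1 z - 1) + cmod (g1 z) < 1"
    "z \<noteq> 0 \<Longrightarrow> Re ((z * (h1 z + z * h2 z) + cnj (z * (g1 z + z * g2 z))) / (z * h1 z - cnj (z * g1 z))) > \<alpha>"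
    if "cmod z < r_C \<alpha>" for z
  proof -
    note errors = total_error_bound[OF \<alpha> a b that]
    show "cmod (h1 z - 1) + cmod (g1 z) < 1"
      using near_identity_if_small_errors[OF \<alpha> errors] by (simp only: h1_def g1_def)
    show "Re ((z * (h1 z + z * h2 z) + cnj (z * (g1 z + z * g2 z))) / (z * h1 z - cnj (z * g1 z))) > \<alpha>"
      if "z \<noteq> 0"
      using turning_if_small_errors[OF \<alpha> that errors] by (simp only: h1_def h2_def g1_def g2_def)
  qed

  have inj: "inj_on f (ball 0 (r_C \<alpha>))"
  proof (rule inj_on_if_derivative_near_identity)
    fix z :: complex assume "z \<in> ball 0 (r_C \<alpha>)"
    hence z: "cmod z < r_C \<alpha>" "cmod z < 1" using R by auto
    show "(f has_derivative (\<lambda>w. h1 z * w + cnj (g1 z * w))) (at z)"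
      by (rule has_derivative_transform_within_open[OF has_derivative_add_cnj[OF dh(1) dg(1)], of z "ball 0 1"])
         (use z f' in auto)
    show "cmod (h1 z - 1) + cmod (g1 z) < 1" by (rule pointwise(1)[OF z(1)])
  qed simp

  moreover have "fully_convex_of_order \<alpha> f (r_C \<alpha>)"
    unfolding fully_convex_of_order_def
  proof (intro conjI allI impI ballI)
    show "harmonic_on f (ball 0 (r_C \<alpha>))"
    proof (rule harmonic_on_add_cnj[OF open_ball])
      fix z :: complex assume "z \<in> ball 0 (r_C \<alpha>)"
      hence z: "cmod z < 1" using R by simp
      show "(h has_field_derivative h1 z) (at z)" "(h1 has_field_derivative h2 z) (at z)"
        by (rule dh[OF z])+
      show "(g has_field_derivative g1 z) (at z)" "(g1 has_field_derivative g2 z) (at z)"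
        by (rule dg[OF z])+
      show "f z = h z + cnj (g z)" by (rule f'[OF z])
    next
      show "continuous_on (ball 0 (r_C \<alpha>)) h2"
        using R by (intro continuous_at_imp_continuous_on ballI dh(3)) simp
      show "continuous_on (ball 0 (r_C \<alpha>)) g2"
        using R by (intro continuous_at_imp_continuous_on ballI dg(3)) simp
    qed
  next
    fix r :: real assume r: "0 < r \<and> r < r_C \<alpha>"
    show "inj_on f (sphere 0 r)" using inj by (rule inj_on_subset) (use r in auto)
    define \<zeta> where "\<zeta> t = of_real r * cis t" for t
    have \<zeta>: "cmod (\<zeta> t) = r" "cmod (\<zeta> t) < r_C \<alpha>" "cmod (\<zeta> t) < 1" "\<zeta> t \<noteq> 0" for t
      using r R by (auto simp: \<zeta>_def norm_mult)
    \<comment> \<open>\<open>w\<close> and \<open>w'\<close> are the velocity \<open>\<i> B\<close> and the acceleration \<open>\<i>\<^sup>2 A = - A\<close> of the image of the circle.\<close>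
    define w where "w t = \<i> * (\<zeta> t * h1 (\<zeta> t) - cnj (\<zeta> t * g1 (\<zeta> t)))" for t
    define w' where "w' t = - (\<zeta> t * (h1 (\<zeta> t) + \<zeta> t * h2 (\<zeta> t)) + cnj (\<zeta> t * (g1 (\<zeta> t) + \<zeta> t * g2 (\<zeta> t))))" for t
    have d\<zeta>: "(\<zeta> has_vector_derivative \<i> * \<zeta> t) (at t)" for t
      unfolding has_vector_derivative_complex_iff \<zeta>_def
      by (auto intro!: derivative_eq_intros)
    have chain: "((\<lambda>t. k (\<zeta> t)) has_vector_derivative \<i> * \<zeta> t * k') (at t)"
      if "(k has_field_derivative k') (at (\<zeta> t))" for k k' t
      using field_vector_diff_chain_at[OF d\<zeta> that] by (simp add: o_def)
    have dF: "((\<lambda>t. f (\<zeta> t)) has_vector_derivative w t) (at t)" for t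
    proof -
      have "((\<lambda>t. h (\<zeta> t) + cnj (g (\<zeta> t))) has_vector_derivative
          \<i> * \<zeta> t * h1 (\<zeta> t) + cnj (\<i> * \<zeta> t * g1 (\<zeta> t))) (at t)"
        by (intro has_vector_derivative_add has_vector_derivative_cnj chain dh dg \<zeta>)
      thus ?thesis using \<zeta> by (simp add: f' w_def algebra_simps)
    qed
    have dw: "(w has_vector_derivative w' t) (at t)" for t
    proof -
      have "(w has_vector_derivative \<i> * ((\<zeta> t * (\<i> * \<zeta> t * h2 (\<zeta> t)) + \<i> * \<zeta> t * h1 (\<zeta> t))
          - cnj (\<zeta> t * (\<i> * \<zeta> t * g2 (\<zeta> t)) + \<i> * \<zeta> t * g1 (\<zeta> t)))) (at t)"
        unfolding w_def
        by (intro has_vector_derivative_mult_right has_vector_derivative_diff has_vector_derivative_mult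
            has_vector_derivative_cnj chain dh dg \<zeta> d\<zeta>)
      also have "\<i> * ((\<zeta> t * (\<i> * \<zeta> t * h2 (\<zeta> t)) + \<i> * \<zeta> t * h1 (\<zeta> t))
          - cnj (\<zeta> t * (\<i> * \<zeta> t * g2 (\<zeta> t)) + \<i> * \<zeta> t * g1 (\<zeta> t))) = w' t"
        by (simp add: w'_def complex_eq_iff algebra_simps)
      finally show ?thesis .
    qed
    have half_plane: "Re (w t * cnj (\<i> * cis t)) > 0" for t
    proof -
      have "w t * cnj (\<i> * cis t) = of_real r * h1 (\<zeta> t) - cnj (\<zeta> t * g1 (\<zeta> t) * cis t)"
        by (simp add: w_def \<zeta>_def algebra_simps cis_cnj cis_mult)
      moreover have "Re (of_real r * x - cnj y) = r * Re x - Re y" for x y by simp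
      ultimately have eq: "Re (w t * cnj (\<i> * cis t)) = r * Re (h1 (\<zeta> t)) - Re (\<zeta> t * g1 (\<zeta> t) * cis t)"
        by (simp only:)
      have "Re (\<zeta> t * g1 (\<zeta> t) * cis t) \<le> r * cmod (g1 (\<zeta> t))"
        using complex_Re_le_cmod[of "\<zeta> t * g1 (\<zeta> t) * cis t"] \<zeta>(1) by (simp add: norm_mult)
      moreover have "1 - Re (h1 (\<zeta> t)) \<le> cmod (h1 (\<zeta> t) - 1)"
        using complex_Re_le_cmod[of "1 - h1 (\<zeta> t)"] by (simp add: norm_minus_commute)
      hence "cmod (g1 (\<zeta> t)) < Re (h1 (\<zeta> t))" using pointwise(1)[OF \<zeta>(2), of t] by linarith
      hence "r * cmod (g1 (\<zeta> t)) < r * Re (h1 (\<zeta> t))" using r by simp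
      ultimately show ?thesis using eq by linarith
    qed
    have turning: "Im (w' t / w t) > \<alpha>" for t
    proof -
      have rotate: "Im (- A / (\<i> * B)) = Re (A / B)" for A B :: complex
      proof -
        have "- A / (\<i> * B) = \<i> * (A / B)" by (simp add: divide_simps)
        thus ?thesis by (simp only: Im_i_times)
      qed
      thus ?thesis using pointwise(2)[OF \<zeta>(2,4), of t] unfolding w_def w'_def by (simp only: rotate)
    qed
    have "f ` sphere 0 r = range (\<lambda>t. f (\<zeta> t))"
    proof -
      have "\<exists>t. z = \<zeta> t" if "cmod z = r" for z
        using rcis_cmod_Arg[of z] that by (intro exI[of _ "Arg z"]) (simp add: \<zeta>_def rcis_def)
      hence "sphere 0 r = range \<zeta>" using \<zeta>(1) by (auto simp: image_iff)
      thus ?thesis by (simp add: image_image)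
    qed
    moreover have "convex_curve (range (\<lambda>t. f (\<zeta> t)))"
    proof (rule convex_curve_if_locally_strictly_convex[OF dF dw half_plane])
      have period: "\<zeta> (t + 2 * pi) = \<zeta> t" for t by (simp add: \<zeta>_def flip: cis_mult)
      fix t
      show "Im (w' t / w t) > 0" by (rule order_le_less_trans[OF \<alpha>(1) turning])
      show "f (\<zeta> (t + 2 * pi)) = f (\<zeta> t)" by (simp only: period)
      show "w (t + 2 * pi) = w t" by (simp only: w_def period)
    qed
    ultimately show "convex_curve (f ` sphere 0 r)" by simp

    fix \<theta> :: real
    obtain \<psi> where polar: "\<And>t. w t = of_real (cmod (w t)) * cis (\<psi> t)"
      and d\<psi>: "\<And>t. (\<psi> has_real_derivative Im (w' t / w t)) (at t)"
      and "\<And>t. \<bar>\<psi> t - t\<bar> < 2 * pi"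
      and "\<And>s t. w s = w t \<Longrightarrow> cis s = cis t \<Longrightarrow> \<psi> s - s = \<psi> t - t"
      by (rule tangent_angle_lift[OF dw half_plane]) (rule that; assumption)
    have w0: "w t \<noteq> 0" for t using half_plane[of t] by auto
    have "has_arg_derivative w (Im (w' \<theta> / w \<theta>)) \<theta>"
      unfolding has_arg_derivative_def
      by (intro exI[of _ \<psi>] conjI always_eventually allI polar d\<psi> w0)
    moreover have "(\<lambda>t. vector_derivative (\<lambda>s. f (of_real r * cis s)) (at t)) = w"
      using dF by (intro ext vector_derivative_at) (simp add: \<zeta>_def[abs_def])
    ultimately show "\<exists>D>\<alpha>. has_arg_derivative
        (\<lambda>t. vector_derivative (\<lambda>s. f (of_real r * cis s)) (at t)) D \<theta>"
      using turning by auto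
  qed
  ultimately show ?thesis ..
qed

theorem theorem3p7:
  fixes \<alpha> :: real and a b :: "nat \<Rightarrow> complex" and f h g :: "complex \<Rightarrow> complex"
  assumes "0 \<le> \<alpha>" and "\<alpha> < 1"
    and "a 1 = 1"
    and "\<And>n. n \<ge> 1 \<Longrightarrow> cmod (a n) \<le> (real n + 1) / 2"
    and "\<And>n. n \<ge> 1 \<Longrightarrow> cmod (b n) \<le> (real n - 1) / 2"
    and "\<And>z. cmod z < 1 \<Longrightarrow> h z = z + (\<Sum>n. a (n + 2) * z ^ (n + 2))"
    and "\<And>z. cmod z < 1 \<Longrightarrow> g z = (\<Sum>n. b (n + 1) * z ^ (n + 1))"
    and "\<And>z. cmod z < 1 \<Longrightarrow> f z = h z + cnj (g z)"
  shows "(\<exists>!r. rC_root \<alpha> r) \<and>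
         inj_on f (ball 0 (r_C \<alpha>)) \<and>
         fully_convex_of_order \<alpha> f (r_C \<alpha>) \<and>
         (\<exists>!r. rC_root 0 r) \<and>
         \<bar>r_C 0 - 0.0903331\<bar> \<le> 5 / 10^8 \<and>
         inj_on f (ball 0 (r_C 0)) \<and>
         fully_convex f (r_C 0)"
proof -
  \<comment> \<open>With coefficient \<open>0\<close> at index \<open>0\<close>, the shifted series for \<open>h\<close> and \<open>g\<close> become full power series.\<close>
  define a' b' where "a' n = (if n = 0 then 0 else a n)" and "b' n = (if n = 0 then 0 else b n)" for n
  have a': "a' 0 = 0" "a' 1 = 1" "\<And>n. n \<ge> 1 \<Longrightarrow> cmod (a' n) \<le> (real n + 1) / 2"
    and b': "b' 0 = 0" "\<And>n. n \<ge> 1 \<Longrightarrow> cmod (b' n) \<le> (real n - 1) / 2"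
    using assms(3-5) by (auto simp: a'_def b'_def)
  have growth: "cmod (a' n) \<le> real n + 1" "cmod (b' n) \<le> real n + 1" for n
    using a'(1) a'(3)[of n] b'(1) b'(2)[of n] by (cases "n = 0"; simp)+
  have f: "f z = powser a' z + cnj (powser b' z)" if z: "cmod z < 1" for z
  proof -
    have "powser a' z = h z"
      using powser_eq_shifted_twice[OF summable_if_linear_growth[OF growth(1) z]] assms(3,6) z
      by (simp add: a'_def[abs_def])
    moreover have "powser b' z = g z"
      using powser_eq_shifted[OF summable_if_linear_growth[OF growth(2) z]] assms(7) z
      by (simp add: b'_def[abs_def])
    ultimately show ?thesis using assms(8) z by simp
  qed
  show ?thesis
    using univalent_and_fully_convex[OF assms(1,2) a' b' f]
      univalent_and_fully_convex[of 0, OF _ _ a' b' f]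
      rC_root_ex1[OF assms(1,2)] rC_root_ex1[of 0] r_C_0_approx
    by simp
qed

end
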